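(* Let $M$ be a differentiable manifold, $U\subset M$ a subset and $D$ an $S$-derivation. If there exist bases (defined in a neighborhood of $U$) in which the components of $D$ along every vector field vanish on $U$, then all of them are obtained from one another by linear transformations whose coefficients are such that the action on them of the corresponding basic vectors vanishes on $U$; that is, if $\{E_i\}$ and $\{E_{i'}=A^i_{i'}E_i\}$ are two such bases, then $E_j(A^i_{i'})|_U=0$ for all $i,j,i'$.
   Context: $M$ is a real differentiable manifold, $n=\dim M$; repeated Latin indices are summed from $1$ to $n$; $X(f)$ denotes the action of a vector field $X$ on a $C^1$ function $f$. Let $S: X\mapsto S_X$ be a fixed map (no linearity in $X$ is assumed) from the set of $C^1$ vector fields on $M$ to tensor fields of type $(1,1)$, each $S_X$ being regarded as a derivation of the tensor algebra. The $S$-derivation $D$ is the map $X\mapsto D_X:=L_X+S_X$, where $L_X$ is the Lie derivative along $X$ (so on vector fields $D_XY=[X,Y]+S_X(Y)$). For a local basis (frame) $\{E_i\}$ of vector fields (holonomic or not), the components $(W_X)^i_{\ j}$ of $D$ along $X$ are defined by $D_X(E_j)=(W_X)^i_{\ j}E_i$. A change of basis is given by $E_{i'}=A^i_{i'}E_i$ with $A=[A^i_{i'}]$ a nondegenerate matrix function. *)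

theory Defs
  imports "HOL-Analysis.Analysis" "HOL-Library.Function_Algebras"
begin

text \<open>Pointwise scalar multiplication, so that tangent vectors (which are functions on charts,
  see below) live in a real vector space and the library's linear algebra applies.\<close>

instantiation "fun" :: (type, scaleR) scaleR
begin

definition scaleR_fun :: "real \<Rightarrow> ('a \<Rightarrow> 'b) \<Rightarrow> 'a \<Rightarrow> 'b"
  where "scaleR_fun r f = (\<lambda>x. r *\<^sub>R f x)"

instance ..

end

instance "fun" :: (type, real_vector) real_vector
  by standard (auto simp: scaleR_fun_def fun_eq_iff scaleR_add_right scaleR_add_left)


text \<open>\<open>Ck_on k T f\<close>: the map \<open>f\<close> is of class \<open>C\<^sup>k\<close> on \<open>T\<close>. It is used for open \<open>T\<close> in finite-dimensional
  spaces only, where continuity of all directional derivatives of order \<open>k\<close> is continuity of the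
  \<open>k\<close>-th derivative.\<close>

primrec Ck_on :: "nat \<Rightarrow> 'x::real_normed_vector set \<Rightarrow> ('x \<Rightarrow> 'y::real_normed_vector) \<Rightarrow> bool" where
  "Ck_on 0 T f \<longleftrightarrow> continuous_on T f"
| "Ck_on (Suc k) T f \<longleftrightarrow> (\<forall>x\<in>T. f differentiable (at x)) \<and>
     (\<forall>v. Ck_on k T (\<lambda>x. frechet_derivative f (at x) v))"


text \<open>A chart is a pair of its domain and its coordinate map, which is irrelevant off the domain.\<close>

type_synonym ('a, 'n) chart = "'a set \<times> ('a \<Rightarrow> real ^ 'n)"

abbreviation chart_dom :: "('a, 'n) chart \<Rightarrow> 'a set"
  where "chart_dom \<equiv> fst"

abbreviation coord :: "('a, 'n) chart \<Rightarrow> 'a \<Rightarrow> real ^ 'n"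
  where "coord \<equiv> snd"

definition param :: "('a, 'n) chart \<Rightarrow> real ^ 'n \<Rightarrow> 'a"
  where "param c = inv_into (chart_dom c) (coord c)"

definition transition :: "('a, 'n) chart \<Rightarrow> ('a, 'n) chart \<Rightarrow> real ^ 'n \<Rightarrow> real ^ 'n"
  where "transition c c' = coord c' \<circ> param c"

text \<open>Class \<open>C\<^sup>2\<close> is the least regularity for which \<open>C\<^sup>1\<close> vector fields make sense. Since an atlas of
  class \<open>C\<^sup>r\<close>, \<open>2 \<le> r \<le> \<infinity>\<close>, is a \<open>C\<^sup>2\<close> atlas with the same \<open>C\<^sup>1\<close> vector fields and functions, all
  these classes are covered. Manifolds are Hausdorff; second countability is not required.
  The dimension is \<open>CARD('n)\<close>.\<close>

definition differentiable_manifold :: "'a topology \<Rightarrow> ('a, 'n::finite) chart set \<Rightarrow> bool" where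
  "differentiable_manifold M \<A> \<longleftrightarrow>
     Hausdorff_space M \<and>
     (\<Union>c\<in>\<A>. chart_dom c) = topspace M \<and>
     (\<forall>c\<in>\<A>. openin M (chart_dom c) \<and> open (coord c ` chart_dom c) \<and>
        homeomorphic_map (subtopology M (chart_dom c))
          (top_of_set (coord c ` chart_dom c)) (coord c)) \<and>
     (\<forall>c\<in>\<A>. \<forall>c'\<in>\<A>. Ck_on 2 (coord c ` (chart_dom c \<inter> chart_dom c')) (transition c c'))"


text \<open>A tangent vector at \<open>p\<close> is the family of its coordinate vectors in all charts around \<open>p\<close>,
  related by the contravariant transformation law; it is set to \<open>0\<close> on the other pairs, so
  that the family is determined by its components in one chart around \<open>p\<close>.\<close>

type_synonym ('a, 'n) tangent_vector = "('a, 'n) chart \<Rightarrow> real ^ 'n"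

type_synonym ('a, 'n) vector_field = "'a \<Rightarrow> ('a, 'n) tangent_vector"

definition tangent_space :: "('a, 'n::finite) chart set \<Rightarrow> 'a \<Rightarrow> ('a, 'n) tangent_vector set" where
  "tangent_space \<A> p = {v.
     (\<forall>c. \<not> (c \<in> \<A> \<and> p \<in> chart_dom c) \<longrightarrow> v c = 0) \<and>
     (\<forall>c\<in>\<A>. \<forall>c'\<in>\<A>. p \<in> chart_dom c \<inter> chart_dom c' \<longrightarrow>
        v c' = frechet_derivative (transition c c') (at (coord c p)) (v c))}"

text \<open>\<open>C\<^sup>1\<close> vector fields on an open set \<open>V\<close>. They vanish off \<open>V\<close> by convention, so that distinct
  elements are distinct as vector fields on \<open>V\<close>.\<close>

definition C1_vector_fields ::
    "('a, 'n::finite) chart set \<Rightarrow> 'a set \<Rightarrow> ('a, 'n) vector_field set" where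
  "C1_vector_fields \<A> V = {X.
     (\<forall>p\<in>V. X p \<in> tangent_space \<A> p) \<and> (\<forall>p. p \<notin> V \<longrightarrow> X p = 0) \<and>
     (\<forall>c\<in>\<A>. Ck_on 1 (coord c ` (V \<inter> chart_dom c)) (\<lambda>x. X (param c x) c))}"

definition C1_function :: "('a, 'n::finite) chart set \<Rightarrow> 'a set \<Rightarrow> ('a \<Rightarrow> real) \<Rightarrow> bool" where
  "C1_function \<A> V f \<longleftrightarrow> (\<forall>c\<in>\<A>. Ck_on 1 (coord c ` (V \<inter> chart_dom c)) (f \<circ> param c))"

text \<open>The value at \<open>p\<close> of \<open>X(f)\<close>, that is \<open>X\<^sup>k \<partial>\<^sub>k f\<close> in local coordinates; for tangent \<open>X p\<close> and \<open>f\<close>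
  of class \<open>C\<^sup>1\<close> near \<open>p\<close> it does not depend on the chart around \<open>p\<close>.\<close>

definition action ::
    "('a, 'n::finite) chart set \<Rightarrow> ('a, 'n) vector_field \<Rightarrow> ('a \<Rightarrow> real) \<Rightarrow> 'a \<Rightarrow> real" where
  "action \<A> X f p =
     (let c = (SOME c. c \<in> \<A> \<and> p \<in> chart_dom c)
      in frechet_derivative (f \<circ> param c) (at (coord c p)) (X p c))"

text \<open>The commutator \<open>[X, Y]\<close>, in coordinates \<open>[X, Y]\<^sup>i = X\<^sup>k \<partial>\<^sub>k Y\<^sup>i - Y\<^sup>k \<partial>\<^sub>k X\<^sup>i\<close>.\<close>

definition lie_bracket :: "('a, 'n::finite) chart set \<Rightarrow>
    ('a, 'n) vector_field \<Rightarrow> ('a, 'n) vector_field \<Rightarrow> ('a, 'n) vector_field" where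
  "lie_bracket \<A> X Y p = (\<lambda>c.
     if c \<in> \<A> \<and> p \<in> chart_dom c then
       frechet_derivative (\<lambda>x. Y (param c x) c) (at (coord c p)) (X p c)
       - frechet_derivative (\<lambda>x. X (param c x) c) (at (coord c p)) (Y p c)
     else 0)"


text \<open>A tensor field of type \<open>(1,1)\<close>, as a field of endomorphisms of the tangent spaces. No
  dependence on the point is prescribed.\<close>

definition tensor_field_11 :: "'a topology \<Rightarrow> ('a, 'n::finite) chart set \<Rightarrow>
    ('a \<Rightarrow> ('a, 'n) tangent_vector \<Rightarrow> ('a, 'n) tangent_vector) \<Rightarrow> bool" where
  "tensor_field_11 M \<A> T \<longleftrightarrow> (\<forall>p\<in>topspace M.
     (\<forall>v\<in>tangent_space \<A> p. T p v \<in> tangent_space \<A> p) \<and>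
     (\<forall>v\<in>tangent_space \<A> p. \<forall>w\<in>tangent_space \<A> p. T p (v + w) = T p v + T p w) \<and>
     (\<forall>r. \<forall>v\<in>tangent_space \<A> p. T p (r *\<^sub>R v) = r *\<^sub>R T p v))"

text \<open>The \<open>S\<close>-derivation \<open>D\<^sub>X = L\<^sub>X + S\<^sub>X\<close> on vector fields \<open>Y\<close>, which may be defined on an open
  set only; the result is meaningful on that set.\<close>

definition S_derivation :: "('a, 'n::finite) chart set \<Rightarrow>
    (('a, 'n) vector_field \<Rightarrow> 'a \<Rightarrow> ('a, 'n) tangent_vector \<Rightarrow> ('a, 'n) tangent_vector) \<Rightarrow>
    ('a, 'n) vector_field \<Rightarrow> ('a, 'n) vector_field \<Rightarrow> ('a, 'n) vector_field" where
  "S_derivation \<A> S X Y p = lie_bracket \<A> X Y p + S X p (Y p)"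


text \<open>\<open>E\<close> is a local basis of (\<open>C\<^sup>1\<close>) vector fields on \<open>V\<close>, not necessarily holonomic.\<close>

definition local_basis ::
    "('a, 'n::finite) chart set \<Rightarrow> 'a set \<Rightarrow> ('n \<Rightarrow> ('a, 'n) vector_field) \<Rightarrow> bool" where
  "local_basis \<A> V E \<longleftrightarrow>
     (\<forall>i. E i \<in> C1_vector_fields \<A> V) \<and>
     (\<forall>p\<in>V. inj (\<lambda>i. E i p) \<and> independent (range (\<lambda>i. E i p)) \<and>
        span (range (\<lambda>i. E i p)) = tangent_space \<A> p)"

text \<open>\<open>D\<^sub>X(E\<^sub>j) = (W\<^sub>X)\<^sup>i\<^sub>j E\<^sub>i\<close> on \<open>V\<close>, where \<open>(W\<^sub>X)\<^sup>i\<^sub>j\<close> at \<open>p\<close> is \<open>W p $ i $ j\<close>. As \<open>E\<close> is a basis,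
  this determines \<open>W\<close> on \<open>V\<close>.\<close>

definition S_components :: "('a, 'n::finite) chart set \<Rightarrow>
    (('a, 'n) vector_field \<Rightarrow> 'a \<Rightarrow> ('a, 'n) tangent_vector \<Rightarrow> ('a, 'n) tangent_vector) \<Rightarrow>
    'a set \<Rightarrow> ('n \<Rightarrow> ('a, 'n) vector_field) \<Rightarrow> ('a, 'n) vector_field \<Rightarrow>
    ('a \<Rightarrow> real ^ 'n ^ 'n) \<Rightarrow> bool" where
  "S_components \<A> S V E X W \<longleftrightarrow>
     (\<forall>p\<in>V. \<forall>j. S_derivation \<A> S X (E j) p = (\<Sum>i\<in>UNIV. (W p $ i $ j) *\<^sub>R E i p))"

text \<open>\<open>E'\<^sub>i\<^sub>' = A\<^sup>i\<^sub>i\<^sub>' E\<^sub>i\<close> on \<open>V\<close> with a nondegenerate \<open>C\<^sup>1\<close> matrix function, where \<open>A\<^sup>i\<^sub>i\<^sub>'\<close> at \<open>p\<close> is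
  \<open>A p $ i $ i'\<close>.\<close>

definition change_of_basis :: "('a, 'n::finite) chart set \<Rightarrow> 'a set \<Rightarrow>
    ('n \<Rightarrow> ('a, 'n) vector_field) \<Rightarrow> ('n \<Rightarrow> ('a, 'n) vector_field) \<Rightarrow>
    ('a \<Rightarrow> real ^ 'n ^ 'n) \<Rightarrow> bool" where
  "change_of_basis \<A> V E E' A \<longleftrightarrow>
     (\<forall>i i'. C1_function \<A> V (\<lambda>p. A p $ i $ i')) \<and>
     (\<forall>p\<in>V. invertible (A p)) \<and>
     (\<forall>p\<in>V. \<forall>i'. E' i' p = (\<Sum>i\<in>UNIV. (A p $ i $ i') *\<^sub>R E i p))"

end

theory Submission
  imports Defs
begin

text \<open>The idea is the Leibniz rule. Although \<open>X \<mapsto> S\<^sub>X\<close> is arbitrary, each \<open>S\<^sub>X\<close> is linear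
  over functions, so \<open>D\<^sub>X (f Y) = X(f) Y + f D\<^sub>X Y\<close>. Applied to \<open>E'\<^sub>i\<^sub>' = A\<^sup>i\<^sub>i\<^sub>' E\<^sub>i\<close> this gives
  \<open>D\<^sub>X E'\<^sub>i\<^sub>' = X(A\<^sup>i\<^sub>i\<^sub>') E\<^sub>i + A\<^sup>i\<^sub>i\<^sub>' D\<^sub>X E\<^sub>i\<close> (\<open>S_derivation_combination\<close>). At a point \<open>p\<close> of \<open>U\<close> both
  \<open>D\<^sub>X E'\<^sub>i\<^sub>'\<close> and all \<open>D\<^sub>X E\<^sub>i\<close> vanish, and the \<open>E\<^sub>i\<close> are independent, so \<open>X(A\<^sup>i\<^sub>i\<^sub>') = 0\<close> at \<open>p\<close>.

  One wants to put \<open>X = E\<^sub>j\<close>, but \<open>E\<^sub>j\<close> is a local field, while the components are assumed to vanish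
  for fields on the whole of \<open>M\<close>. The number \<open>X(A\<^sup>i\<^sub>i\<^sub>')\<close> at \<open>p\<close> depends on \<open>X\<close> only through its value
  at \<open>p\<close>, so any global \<open>C\<^sup>1\<close> field with the value of \<open>E\<^sub>j\<close> at \<open>p\<close> serves. Such a field is a
  constant field in a chart, multiplied by a bump function and extended by zero
  (\<open>exists_C1_vector_field_with_value\<close>).

  It remains that the matrix \<open>A\<close> relating two bases is of class \<open>C\<^sup>1\<close>; in a chart, Cramer's rule
  writes its entries as quotients of determinants in the components of the basis vectors
  (\<open>exists_change_of_basis\<close>).\<close>

section \<open>Calculus of maps of class C1\<close>

text \<open>Calculus is done with \<open>Ck_on 1\<close> as a closed notion, characterised here once. The simplifier
  would rewrite \<open>1\<close> to \<open>Suc 0\<close> and unfold it into continuity statements.\<close>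

lemma Ck_on_1_iff:
  "Ck_on 1 T f \<longleftrightarrow> (\<forall>x\<in>T. f differentiable (at x)) \<and>
     (\<forall>v. continuous_on T (\<lambda>x. frechet_derivative f (at x) v))"
  by simp

lemma Ck_on_2_iff:
  "Ck_on 2 T f \<longleftrightarrow> (\<forall>x\<in>T. f differentiable (at x)) \<and>
     (\<forall>v. Ck_on 1 T (\<lambda>x. frechet_derivative f (at x) v))"
  by (simp add: numeral_2_eq_2)

lemma Ck_on_1I:
  assumes "\<And>x. x \<in> T \<Longrightarrow> (f has_derivative f' x) (at x)"
    and "\<And>v. continuous_on T (\<lambda>x. f' x v)"
  shows "Ck_on 1 T f"
  unfolding Ck_on_1_iff
proof (intro conjI ballI allI)
  fix x assume "x \<in> T"
  then show "f differentiable (at x)" using assms(1) differentiable_def by blast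
next
  fix v
  show "continuous_on T (\<lambda>x. frechet_derivative f (at x) v)"
    using assms(2)[of v] by (rule continuous_on_eq) (metis assms(1) frechet_derivative_at)
qed

lemma Ck_on_1_has_derivative:
  assumes "Ck_on 1 T f" "x \<in> T"
  shows "(f has_derivative frechet_derivative f (at x)) (at x)"
  using assms by (auto simp: Ck_on_1_iff frechet_derivative_works)

lemma Ck_on_1_continuous_derivative:
  assumes "Ck_on 1 T f"
  shows "continuous_on T (\<lambda>x. frechet_derivative f (at x) v)"
  using assms by (auto simp: Ck_on_1_iff)

lemma Ck_on_1_continuous_on:
  assumes "Ck_on 1 T f" shows "continuous_on T f"
  using assms by (auto simp: Ck_on_1_iff intro!: continuous_at_imp_continuous_on
    differentiable_imp_continuous_within)

lemma Ck_on_1_subset: "Ck_on 1 T f \<Longrightarrow> T' \<subseteq> T \<Longrightarrow> Ck_on 1 T' f"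
  by (auto simp: Ck_on_1_iff intro: continuous_on_subset)

lemma Ck_on_1_cong:
  assumes "Ck_on 1 T f" "open T" "\<And>x. x \<in> T \<Longrightarrow> f x = g x"
  shows "Ck_on 1 T g"
proof (rule Ck_on_1I)
  fix x assume "x \<in> T"
  then show "(g has_derivative frechet_derivative f (at x)) (at x)"
    using Ck_on_1_has_derivative[OF assms(1)] assms(2,3)
    by (metis has_derivative_transform_within_open)
qed (rule Ck_on_1_continuous_derivative[OF assms(1)])

lemma Ck_on_1_Un:
  assumes "Ck_on 1 T f" "Ck_on 1 T' f" "open T" "open T'"
  shows "Ck_on 1 (T \<union> T') f"
  using assms by (auto simp: Ck_on_1_iff intro: continuous_on_open_Un)

lemma Ck_on_1_const: "Ck_on 1 T (\<lambda>x. a)"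
  by (rule Ck_on_1I[where f' = "\<lambda>x v. 0"]) auto

lemma Ck_on_1_bounded_linear:
  assumes "bounded_linear L" "Ck_on 1 T f"
  shows "Ck_on 1 T (\<lambda>x. L (f x))"
  by (rule Ck_on_1I[OF bounded_linear.has_derivative[OF assms(1) Ck_on_1_has_derivative[OF assms(2)]]])
     (auto intro!: bounded_linear.continuous_on[OF assms(1)] Ck_on_1_continuous_derivative[OF assms(2)])

lemma Ck_on_1_bounded_bilinear:
  assumes "bounded_bilinear B" "Ck_on 1 T f" "Ck_on 1 T g"
  shows "Ck_on 1 T (\<lambda>x. B (f x) (g x))"
  by (rule Ck_on_1I[OF bounded_bilinear.FDERIV[OF assms(1) Ck_on_1_has_derivative[OF assms(2)]
          Ck_on_1_has_derivative[OF assms(3)]]])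
     (auto intro!: continuous_on_add bounded_bilinear.continuous_on[OF assms(1)]
        Ck_on_1_continuous_derivative[OF assms(2)] Ck_on_1_continuous_derivative[OF assms(3)]
        Ck_on_1_continuous_on[OF assms(2)] Ck_on_1_continuous_on[OF assms(3)])

lemmas Ck_on_1_scaleR = Ck_on_1_bounded_bilinear[OF bounded_bilinear_scaleR]
lemmas Ck_on_1_mult = Ck_on_1_bounded_bilinear[OF bounded_bilinear_mult]

lemma Ck_on_1_sum:
  assumes "\<And>i. i \<in> I \<Longrightarrow> Ck_on 1 T (f i)"
  shows "Ck_on 1 T (\<lambda>x. \<Sum>i\<in>I. f i x)"
  by (rule Ck_on_1I[OF has_derivative_sum[OF Ck_on_1_has_derivative[OF assms]]])
     (auto intro!: continuous_on_sum Ck_on_1_continuous_derivative[OF assms])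

lemma Ck_on_1_prod:
  fixes f :: "'i \<Rightarrow> 'x::real_normed_vector \<Rightarrow> 'b::{real_normed_algebra, comm_ring_1}"
  assumes "\<And>i. i \<in> I \<Longrightarrow> Ck_on 1 T (f i)"
  shows "Ck_on 1 T (\<lambda>x. \<Prod>i\<in>I. f i x)"
  using assms
proof (induction I rule: infinite_finite_induct)
  case (insert i I)
  have "Ck_on 1 T (\<lambda>x. f i x * (\<Prod>i\<in>I. f i x))"
  proof (rule Ck_on_1_mult)
    show "Ck_on 1 T (f i)" by (rule insert.prems) (rule insertI1)
    show "Ck_on 1 T (\<lambda>x. \<Prod>i\<in>I. f i x)" by (rule insert.IH) (rule insert.prems, rule insertI2)
  qed
  then show ?case by (simp only: prod.insert[OF insert.hyps])
next
  case (infinite I)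
  show ?case unfolding prod.infinite[OF infinite.hyps] by (rule Ck_on_1_const)
next
  case empty
  show ?case unfolding prod.empty by (rule Ck_on_1_const)
qed

lemma Ck_on_1_divide:
  fixes f g :: "'x::real_normed_vector \<Rightarrow> real"
  assumes "Ck_on 1 T f" "Ck_on 1 T g" "\<And>x. x \<in> T \<Longrightarrow> g x \<noteq> 0"
  shows "Ck_on 1 T (\<lambda>x. f x / g x)"
proof (rule Ck_on_1I)
  fix x assume "x \<in> T"
  then show "((\<lambda>x. f x / g x) has_derivative
      (\<lambda>h. - f x * (inverse (g x) * frechet_derivative g (at x) h * inverse (g x))
        + frechet_derivative f (at x) h / g x)) (at x)"
    using assms(3) by (intro has_derivative_divide Ck_on_1_has_derivative[OF assms(1)]
      Ck_on_1_has_derivative[OF assms(2)]) auto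
next
  fix v
  show "continuous_on T (\<lambda>x. - f x * (inverse (g x) * frechet_derivative g (at x) v * inverse (g x))
        + frechet_derivative f (at x) v / g x)"
    using assms(3) by (intro continuous_intros Ck_on_1_continuous_on[OF assms(1)]
      Ck_on_1_continuous_on[OF assms(2)] Ck_on_1_continuous_derivative[OF assms(1)]
      Ck_on_1_continuous_derivative[OF assms(2)]) auto
qed

lemma Ck_on_1_component:
  "Ck_on 1 T f \<Longrightarrow> Ck_on 1 T (\<lambda>x. f x $ i)"
  by (rule Ck_on_1_bounded_linear[OF bounded_linear_vec_nth])

lemma Ck_on_1_compose:
  fixes f :: "'x::real_normed_vector \<Rightarrow> 'y::euclidean_space" and g :: "'y \<Rightarrow> 'z::real_normed_vector"
  assumes "Ck_on 1 T f" "Ck_on 1 T' g" "f ` T \<subseteq> T'"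
  shows "Ck_on 1 T (\<lambda>x. g (f x))"
proof (rule Ck_on_1I)
  fix x assume "x \<in> T"
  then show "((\<lambda>x. g (f x)) has_derivative
      (\<lambda>v. frechet_derivative g (at (f x)) (frechet_derivative f (at x) v))) (at x)"
    using assms(3) by (blast intro: has_derivative_compose[OF Ck_on_1_has_derivative[OF assms(1)]
      Ck_on_1_has_derivative[OF assms(2)]])
next
  fix v
  have lin: "linear (frechet_derivative g (at (f x)))" if "x \<in> T" for x
    using Ck_on_1_has_derivative[OF assms(2), of "f x"] assms(3) that has_derivative_linear by blast
  have *: "continuous_on T (\<lambda>x. frechet_derivative g (at (f x)) b)" for b
    using continuous_on_compose2[OF Ck_on_1_continuous_derivative[OF assms(2)]
        Ck_on_1_continuous_on[OF assms(1)] assms(3)] .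
  \<comment> \<open>Only the continuity in the base point, for a fixed direction, is at hand, so the moving
    direction is expanded in a fixed basis.\<close>
  have "continuous_on T (\<lambda>x. \<Sum>b\<in>Basis. (frechet_derivative f (at x) v \<bullet> b) *\<^sub>R
      frechet_derivative g (at (f x)) b)"
    by (intro continuous_intros * Ck_on_1_continuous_derivative[OF assms(1)])
  then show "continuous_on T (\<lambda>x. frechet_derivative g (at (f x)) (frechet_derivative f (at x) v))"
  proof (rule continuous_on_eq)
    fix x assume "x \<in> T"
    then interpret linear "frechet_derivative g (at (f x))" by (rule lin)
    show "(\<Sum>b\<in>Basis. (frechet_derivative f (at x) v \<bullet> b) *\<^sub>R frechet_derivative g (at (f x)) b)
        = frechet_derivative g (at (f x)) (frechet_derivative f (at x) v)"
      by (simp only: sum[symmetric] scale[symmetric] euclidean_representation)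
  qed
qed

lemma Ck_on_1_det:
  fixes B :: "'x::real_normed_vector \<Rightarrow> real ^ 'n ^ 'n"
  assumes "\<And>i j. Ck_on 1 T (\<lambda>x. B x $ i $ j)"
  shows "Ck_on 1 T (\<lambda>x. det (B x))"
  unfolding det_def
  by (intro Ck_on_1_sum Ck_on_1_mult Ck_on_1_const Ck_on_1_prod assms)

text \<open>The square makes the truncation at \<open>0\<close> differentiable, which is all the smoothness that
  a \<open>C\<^sup>1\<close> bump needs.\<close>

lemma has_real_derivative_positive_part_squared:
  "((\<lambda>t::real. (max 0 t)\<^sup>2) has_real_derivative 2 * max 0 t) (at t)"
proof (cases "t = 0")
  case False
  show ?thesis
  proof (cases "t > 0")
    case True
    have "((\<lambda>t. t\<^sup>2) has_real_derivative 2 * max 0 t) (at t)"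
      using True by (auto intro!: derivative_eq_intros)
    then show ?thesis
      by (rule has_field_derivative_transform_within_open[where S = "{0<..}"]) (use True in auto)
  next
    case nonpos: False
    have "((\<lambda>t. 0) has_real_derivative 2 * max 0 t) (at t)"
      using nonpos by (auto intro!: derivative_eq_intros)
    then show ?thesis
      by (rule has_field_derivative_transform_within_open[where S = "{..<0}"])
         (use nonpos False in auto)
  qed
next
  case True
  have "((\<lambda>h::real. (max 0 h)\<^sup>2 / h) \<longlongrightarrow> 0) (at 0)"
  proof (rule tendsto_rabs_zero_cancel, rule tendsto_sandwich)
    show "\<forall>\<^sub>F h in at (0::real). 0 \<le> \<bar>(max 0 h)\<^sup>2 / h\<bar>" by simp
    show "\<forall>\<^sub>F h in at (0::real). \<bar>(max 0 h)\<^sup>2 / h\<bar> \<le> \<bar>h\<bar>"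
      by (auto simp: max_def power2_eq_square intro!: always_eventually)
    show "((\<lambda>h. \<bar>h\<bar>) \<longlongrightarrow> 0) (at (0::real))" by (rule tendsto_eq_intros refl)+ simp
  qed simp
  then show ?thesis using True by (simp add: DERIV_def)
qed

lemma C1_bump:
  fixes a :: "'x::real_inner"
  assumes "r > 0"
  obtains \<phi> :: "'x \<Rightarrow> real" where "Ck_on 1 UNIV \<phi>" "\<phi> a = 1" "\<And>x. x \<notin> cball a r \<Longrightarrow> \<phi> x = 0"
proof
  define u where "u x = 1 - ((x - a) \<bullet> (x - a)) / r\<^sup>2" for x
  define \<phi> where "\<phi> x = (max 0 (u x))\<^sup>2" for x
  have du: "(u has_derivative (\<lambda>v. - (2 * ((x - a) \<bullet> v)) / r\<^sup>2)) (at x)" for x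
    unfolding u_def using assms
    by (auto intro!: derivative_eq_intros simp: fun_eq_iff inner_commute field_simps)
  show "Ck_on 1 UNIV \<phi>"
  proof (rule Ck_on_1I)
    fix x
    show "(\<phi> has_derivative (\<lambda>v. 2 * max 0 (u x) * (- (2 * ((x - a) \<bullet> v)) / r\<^sup>2))) (at x)"
      unfolding \<phi>_def
      using has_derivative_compose[OF du, OF has_real_derivative_positive_part_squared[unfolded has_field_derivative_def]] .
  next
    fix v
    show "continuous_on UNIV (\<lambda>x. 2 * max 0 (u x) * (- (2 * ((x - a) \<bullet> v)) / r\<^sup>2))"
      unfolding u_def by (intro continuous_intros) (use assms in auto)
  qed
  show "\<phi> a = 1" by (simp add: \<phi>_def u_def)
  show "\<phi> x = 0" if "x \<notin> cball a r" for x
  proof -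
    have "r\<^sup>2 \<le> (norm (x - a))\<^sup>2"
      using that assms by (intro power_mono) (auto simp: dist_norm norm_minus_commute)
    then have "u x \<le> 0" using assms by (simp add: u_def power2_norm_eq_inner)
    then show ?thesis by (simp add: \<phi>_def max_def)
  qed
qed

section \<open>Pointwise algebra of frames\<close>

lemma sum_fun_apply: "(\<Sum>i\<in>I. f i) x = (\<Sum>i\<in>I. f i x)"
  by (induction I rule: infinite_finite_induct) auto

lemma scaleR_fun_apply [simp]: "(r *\<^sub>R f) x = r *\<^sub>R f x"
  by (simp add: scaleR_fun_def)

lemma basis_combination_eq_0:
  assumes "local_basis \<A> V E" "p \<in> V" "(\<Sum>i\<in>UNIV. a i *\<^sub>R E i p) = 0"
  shows "a i = 0"
proof -
  let ?e = "\<lambda>i. E i p"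
  have inj: "inj ?e" and ind: "independent (range ?e)"
    using assms(1,2) by (auto simp: local_basis_def)
  have inv: "inv ?e (E k p) = k" for k using inv_f_f[OF inj, of k] by simp
  have "(\<Sum>w\<in>range ?e. a (inv ?e w) *\<^sub>R w) = 0"
    using assms(3) inj by (simp add: sum.reindex inv)
  then have "a (inv ?e (?e i)) = 0"
    using independentD[OF ind, of "range ?e" "\<lambda>w. a (inv ?e w)" "?e i"] by simp
  then show ?thesis by (simp add: inv)
qed

lemma local_basis_Ck_on_1:
  assumes "local_basis \<A> V E" "c \<in> \<A>"
  shows "Ck_on 1 (coord c ` (V \<inter> chart_dom c)) (\<lambda>x. E i (param c x) c)"
  using assms unfolding local_basis_def C1_vector_fields_def by blast

lemma subspace_tangent_space:
  assumes "local_basis \<A> V E" "p \<in> V"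
  shows "subspace (tangent_space \<A> p)"
  using assms subspace_span unfolding local_basis_def by metis

lemma basis_in_tangent_space:
  assumes "local_basis \<A> V E" "p \<in> V"
  shows "E i p \<in> tangent_space \<A> p"
  using assms unfolding local_basis_def C1_vector_fields_def by blast

section \<open>Charts and tangent spaces\<close>

context
  fixes M :: "'a topology" and \<A> :: "('a, 'n::finite) chart set"
  assumes mfd: "differentiable_manifold M \<A>"
begin

lemma Hausdorff: "Hausdorff_space M"
  and chart_cover: "(\<Union>c\<in>\<A>. chart_dom c) = topspace M"
  and openin_chart_dom: "c \<in> \<A> \<Longrightarrow> openin M (chart_dom c)"
  and coord_homeomorphic: "c \<in> \<A> \<Longrightarrow> homeomorphic_map (subtopology M (chart_dom c))
          (top_of_set (coord c ` chart_dom c)) (coord c)"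
  and open_coord_dom: "c \<in> \<A> \<Longrightarrow> open (coord c ` chart_dom c)"
  and transition_C2: "c \<in> \<A> \<Longrightarrow> c' \<in> \<A> \<Longrightarrow>
      Ck_on 2 (coord c ` (chart_dom c \<inter> chart_dom c')) (transition c c')"
  using mfd by (auto simp: differentiable_manifold_def)

lemma chart_dom_subset: "c \<in> \<A> \<Longrightarrow> chart_dom c \<subseteq> topspace M"
  using chart_cover by blast

lemma topspace_chart: "c \<in> \<A> \<Longrightarrow> topspace (subtopology M (chart_dom c)) = chart_dom c"
  using chart_dom_subset by (simp add: Int_absorb1)

lemma inj_on_coord: "c \<in> \<A> \<Longrightarrow> inj_on (coord c) (chart_dom c)"
  using homeomorphic_imp_injective_map[OF coord_homeomorphic] topspace_chart by metis

lemma param_coord [simp]: "c \<in> \<A> \<Longrightarrow> q \<in> chart_dom c \<Longrightarrow> param c (coord c q) = q"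
  by (simp add: param_def inj_on_coord)

lemma transition_coord [simp]:
  "c \<in> \<A> \<Longrightarrow> q \<in> chart_dom c \<Longrightarrow> transition c c' (coord c q) = coord c' q"
  by (simp add: transition_def)

lemma open_coord_image:
  assumes "c \<in> \<A>" "openin M W"
  shows "open (coord c ` (W \<inter> chart_dom c))"
proof -
  have "openin (subtopology M (chart_dom c)) (W \<inter> chart_dom c)"
    using assms(2) openin_subtopology by blast
  then have "openin (top_of_set (coord c ` chart_dom c)) (coord c ` (W \<inter> chart_dom c))"
    using homeomorphic_map_openness[OF coord_homeomorphic[OF assms(1)], of "W \<inter> chart_dom c"]
    by (simp only: topspace_chart[OF assms(1)] Int_lower2 simp_thms)
  then show ?thesis
    using open_coord_dom[OF assms(1)] openin_open_trans by blast
qed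

lemma transition_has_derivative:
  assumes "c \<in> \<A>" "c' \<in> \<A>" "q \<in> chart_dom c" "q \<in> chart_dom c'"
  shows "(transition c c' has_derivative frechet_derivative (transition c c') (at (coord c q)))
    (at (coord c q))"
  using transition_C2[OF assms(1,2)] assms(3,4)
  by (auto simp: Ck_on_2_iff frechet_derivative_works simp del: One_nat_def)

lemma linear_transition_derivative:
  assumes "c \<in> \<A>" "c' \<in> \<A>" "q \<in> chart_dom c" "q \<in> chart_dom c'"
  shows "linear (frechet_derivative (transition c c') (at (coord c q)))"
  using transition_has_derivative[OF assms] has_derivative_linear by blast

text \<open>The cocycle law. It is why prescribing the components of a vector in one chart around \<open>q\<close>
  yields a consistent tangent vector.\<close>

lemma transition_derivative_chain:
  assumes "c \<in> \<A>" "c1 \<in> \<A>" "c2 \<in> \<A>" "q \<in> chart_dom c" "q \<in> chart_dom c1" "q \<in> chart_dom c2"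
  shows "frechet_derivative (transition c c2) (at (coord c q)) v =
    frechet_derivative (transition c1 c2) (at (coord c1 q))
      (frechet_derivative (transition c c1) (at (coord c q)) v)"
proof -
  let ?N = "coord c ` (chart_dom c1 \<inter> chart_dom c)"
  have "((\<lambda>x. transition c1 c2 (transition c c1 x)) has_derivative
      (\<lambda>v. frechet_derivative (transition c1 c2) (at (coord c1 q))
        (frechet_derivative (transition c c1) (at (coord c q)) v))) (at (coord c q))"
    using has_derivative_compose[OF transition_has_derivative[of c c1 q],
        of "transition c1 c2"] transition_has_derivative[of c1 c2 q] assms by simp
  then have "(transition c c2 has_derivative
      (\<lambda>v. frechet_derivative (transition c1 c2) (at (coord c1 q))
        (frechet_derivative (transition c c1) (at (coord c q)) v))) (at (coord c q))"
  proof (rule has_derivative_transform_within_open)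
    show "open ?N" using assms by (intro open_coord_image openin_chart_dom)
  qed (use assms in auto)
  then show ?thesis by (metis frechet_derivative_at)
qed

lemma tangent_space_chart_change:
  assumes "v \<in> tangent_space \<A> p" "c \<in> \<A>" "p \<in> chart_dom c" "c' \<in> \<A>" "p \<in> chart_dom c'"
  shows "v c' = frechet_derivative (transition c c') (at (coord c p)) (v c)"
  using assms unfolding tangent_space_def by blast

lemma tangent_space_off_chart:
  assumes "v \<in> tangent_space \<A> p" "\<not> (c \<in> \<A> \<and> p \<in> chart_dom c)"
  shows "v c = 0"
  using assms unfolding tangent_space_def by blast

lemma tangent_vector_eqI:
  assumes "v \<in> tangent_space \<A> p" "w \<in> tangent_space \<A> p" "c \<in> \<A>" "p \<in> chart_dom c" "v c = w c"
  shows "v = w"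
proof
  fix c'
  show "v c' = w c'"
  proof (cases "c' \<in> \<A> \<and> p \<in> chart_dom c'")
    case True
    then show ?thesis
      using tangent_space_chart_change[of v p c c'] tangent_space_chart_change[of w p c c'] assms by simp
  next
    case False
    then show ?thesis using assms(1,2) by (simp add: tangent_space_off_chart)
  qed
qed

lemma Ck_on_1_transition_derivative:
  assumes "c \<in> \<A>" "c' \<in> \<A>"
  shows "Ck_on 1 (coord c ` (chart_dom c \<inter> chart_dom c'))
    (\<lambda>y. frechet_derivative (transition c c') (at y) v)"
  using transition_C2[OF assms] unfolding Ck_on_2_iff by blast

lemma Ck_on_1_transition:
  assumes "c \<in> \<A>" "c' \<in> \<A>"
  shows "Ck_on 1 (coord c ` (chart_dom c \<inter> chart_dom c')) (transition c c')"
  using transition_C2[OF assms] unfolding Ck_on_2_iff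
  by (subst Ck_on_1_iff) (blast intro: Ck_on_1_continuous_on)

section \<open>Global extension of tangent vectors\<close>

text \<open>A bump supported in a compact subset \<open>K\<close> of a chart domain cuts off the field that is constant
  in that chart. The Hausdorff property enters through \<open>K\<close> being closed in \<open>M\<close>: every other chart
  domain is then covered by two open sets, the overlap with the first chart, where the field is
  given by the bump and a derivative of a transition map (of class \<open>C\<^sup>1\<close> as the atlas is \<open>C\<^sup>2\<close>), and
  the complement of \<open>K\<close>, where it is zero.\<close>

lemma exists_C1_vector_field_with_value:
  assumes p: "p \<in> topspace M" and v: "v \<in> tangent_space \<A> p"
  obtains X where "X \<in> C1_vector_fields \<A> (topspace M)" "X p = v"
proof -
  obtain c where c: "c \<in> \<A>" "p \<in> chart_dom c" using p chart_cover by blast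
  define G where "G = coord c ` chart_dom c"
  have "open G" "coord c p \<in> G" using open_coord_dom c by (auto simp: G_def)
  then obtain r where r: "r > 0" "cball (coord c p) r \<subseteq> G" using open_contains_cball by blast
  obtain \<phi> :: "real ^ 'n \<Rightarrow> real" where \<phi>: "Ck_on 1 UNIV \<phi>" "\<phi> (coord c p) = 1"
      "\<And>x. x \<notin> cball (coord c p) r \<Longrightarrow> \<phi> x = 0"
    using C1_bump[OF r(1), of "coord c p"] by blast
  define K where "K = {q \<in> chart_dom c. coord c q \<in> cball (coord c p) r}"
  have K_image: "coord c ` K = cball (coord c p) r"
    using r(2) by (auto simp: K_def G_def)
  have "compactin (top_of_set G) (coord c ` K)"
    unfolding K_image using r(2) by (simp add: compactin_subtopology)
  then have "compactin (subtopology M (chart_dom c)) K"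
    using homeomorphic_map_compactness[OF coord_homeomorphic[OF c(1)], of K]
    by (simp only: topspace_chart[OF c(1)] G_def simp_thms) (auto simp: K_def)
  then have closed: "closedin M K"
    using Hausdorff compactin_imp_closedin compactin_subtopology by blast
  have off_K: "\<phi> (coord c q) = 0" if "q \<in> chart_dom c" "q \<notin> K" for q
    using that by (intro \<phi>(3)) (auto simp: K_def)
  define X where "X q c' = (if c' \<in> \<A> \<and> q \<in> chart_dom c' \<and> q \<in> chart_dom c
      then \<phi> (coord c q) *\<^sub>R frechet_derivative (transition c c') (at (coord c q)) (v c) else 0)"
    for q and c'
  have "X \<in> C1_vector_fields \<A> (topspace M)"
    unfolding C1_vector_fields_def
  proof (intro CollectI conjI ballI allI impI)
    fix q assume "q \<in> topspace M"
    show "X q \<in> tangent_space \<A> q"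
      unfolding tangent_space_def
    proof (intro CollectI conjI ballI allI impI)
      fix c1 assume "\<not> (c1 \<in> \<A> \<and> q \<in> chart_dom c1)"
      then show "X q c1 = 0" by (auto simp: X_def)
    next
      fix c1 c2 assume *: "c1 \<in> \<A>" "c2 \<in> \<A>" "q \<in> chart_dom c1 \<inter> chart_dom c2"
      then interpret linear "frechet_derivative (transition c1 c2) (at (coord c1 q))"
        by (auto intro: linear_transition_derivative)
      show "X q c2 = frechet_derivative (transition c1 c2) (at (coord c1 q)) (X q c1)"
        using * c(1) by (simp add: X_def zero scale transition_derivative_chain[of c c1 c2 q])
    qed
  next
    fix q assume "q \<notin> topspace M"
    then show "X q = 0" using chart_dom_subset[OF c(1)] by (auto simp: X_def fun_eq_iff)
  next
    fix c' assume c': "c' \<in> \<A>"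
    let ?T1 = "coord c' ` (chart_dom c \<inter> chart_dom c')"
    let ?T2 = "coord c' ` ((topspace M - K) \<inter> chart_dom c')"
    have open1: "open ?T1" by (intro open_coord_image openin_chart_dom c c')
    have open2: "open ?T2" using closed by (intro open_coord_image c') auto
    have "Ck_on 1 ?T1 (\<lambda>x. \<phi> (transition c' c x) *\<^sub>R
        frechet_derivative (transition c c') (at (transition c' c x)) (v c))"
    proof (rule Ck_on_1_scaleR)
      have tr: "Ck_on 1 ?T1 (transition c' c)"
        using Ck_on_1_transition[OF c' c(1)] by (simp only: Int_commute)
      show "Ck_on 1 ?T1 (\<lambda>x. \<phi> (transition c' c x))"
        by (rule Ck_on_1_compose[OF tr \<phi>(1)]) simp
      show "Ck_on 1 ?T1 (\<lambda>x. frechet_derivative (transition c c') (at (transition c' c x)) (v c))"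
        by (rule Ck_on_1_compose[OF tr Ck_on_1_transition_derivative[OF c(1) c', of "v c"]])
           (use c' in auto)
    qed
    then have "Ck_on 1 ?T1 (\<lambda>x. X (param c' x) c')"
      by (rule Ck_on_1_cong[OF _ open1]) (use c' in \<open>auto simp: X_def\<close>)
    moreover have "Ck_on 1 ?T2 (\<lambda>x. X (param c' x) c')"
      by (rule Ck_on_1_cong[OF Ck_on_1_const[of _ 0] open2])
         (use c' in \<open>auto simp: X_def off_K\<close>)
    ultimately have "Ck_on 1 (?T1 \<union> ?T2) (\<lambda>x. X (param c' x) c')"
      using open1 open2 by (rule Ck_on_1_Un)
    moreover have "?T1 \<union> ?T2 = coord c' ` (topspace M \<inter> chart_dom c')"
      using chart_dom_subset[OF c(1)] by (auto simp: K_def)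
    ultimately show "Ck_on 1 (coord c' ` (topspace M \<inter> chart_dom c')) (\<lambda>x. X (param c' x) c')"
      by simp
  qed
  moreover have "X p = v"
  proof
    fix c'
    show "X p c' = v c'"
    proof (cases "c' \<in> \<A> \<and> p \<in> chart_dom c'")
      case True
      then show ?thesis
        using tangent_space_chart_change[OF v c, of c'] c \<phi>(2) by (simp add: X_def)
    next
      case False
      then show ?thesis using tangent_space_off_chart[OF v, of c'] by (auto simp: X_def)
    qed
  qed
  ultimately show thesis by (rule that)
qed

section \<open>The change of basis matrix\<close>

text \<open>A tangent vector is determined by its components in a single chart, so independence of the
  basis vectors can be tested there.\<close>

lemma basis_combination_in_chart_eq_0:
  assumes "local_basis \<A> V E" "p \<in> V" "c \<in> \<A>" "p \<in> chart_dom c"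
    and "(\<Sum>i\<in>UNIV. a i *\<^sub>R E i p c) = 0"
  shows "a i = 0"
proof (rule basis_combination_eq_0[OF assms(1,2)])
  have ss: "subspace (tangent_space \<A> p)" using subspace_tangent_space[OF assms(1,2)] .
  show "(\<Sum>i\<in>UNIV. a i *\<^sub>R E i p) = 0"
  proof (rule tangent_vector_eqI[OF _ _ assms(3,4)])
    show "(\<Sum>i\<in>UNIV. a i *\<^sub>R E i p) \<in> tangent_space \<A> p"
      using ss basis_in_tangent_space[OF assms(1,2)] by (intro subspace_sum subspace_scale)
    show "0 \<in> tangent_space \<A> p" using ss subspace_0 by blast
  qed (simp add: assms(5) sum_fun_apply)
qed

text \<open>Pointwise, \<open>A\<close> is the matrix of coordinates of \<open>E'\<close> with respect to \<open>E\<close>, invertible because the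
  \<open>E'\<^sub>i\<^sub>'\<close> are independent. In a chart, with \<open>B\<close> the matrix whose columns are the components of the
  \<open>E\<^sub>j\<close>, each column of \<open>A\<close> solves a linear system with matrix \<open>B\<close>, and Cramer's rule shows that the
  solution is as smooth as \<open>B\<close> and the right-hand side.\<close>

lemma exists_change_of_basis:
  assumes V: "openin M V" "local_basis \<A> V E" and V': "openin M V'" "local_basis \<A> V' E'"
  shows "\<exists>A. change_of_basis \<A> (V \<inter> V') E E' A"
proof -
  have "\<exists>a. E' i' p = (\<Sum>i\<in>UNIV. a i *\<^sub>R E i p)" if p: "p \<in> V \<inter> V'" for p i'
  proof -
    have "E' i' p \<in> span (range (\<lambda>i. E i p))"
      using basis_in_tangent_space[OF V'(2), of p i'] V(2) p by (simp add: local_basis_def)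
    then obtain u where "E' i' p = (\<Sum>w\<in>range (\<lambda>i. E i p). u w *\<^sub>R w)"
      by (subst (asm) span_finite) (auto simp del: scaleR_fun_apply)
    moreover have "inj (\<lambda>i. E i p)" using V(2) p by (simp add: local_basis_def)
    ultimately have "E' i' p = (\<Sum>i\<in>UNIV. u (E i p) *\<^sub>R E i p)" by (simp add: sum.reindex)
    then show ?thesis by (intro exI[of _ "\<lambda>i. u (E i p)"])
  qed
  note a = someI_ex[OF this]
  define A :: "'a \<Rightarrow> real ^ 'n ^ 'n" where
    "A p = (\<chi> i i'. (SOME a. E' i' p = (\<Sum>i\<in>UNIV. a i *\<^sub>R E i p)) i)" for p
  have A: "E' i' p = (\<Sum>i\<in>UNIV. (A p $ i $ i') *\<^sub>R E i p)" if "p \<in> V \<inter> V'" for p i'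
    using a[OF that] by (simp add: A_def)
  have "invertible (A p)" if p: "p \<in> V \<inter> V'" for p
  proof -
    have "x = 0" if x: "A p *v x = 0" for x
    proof -
      have "(\<Sum>i'\<in>UNIV. (x $ i') *\<^sub>R E' i' p) = (\<Sum>i'\<in>UNIV. \<Sum>i\<in>UNIV. (A p $ i $ i' * x $ i') *\<^sub>R E i p)"
        by (simp add: A[OF p] scaleR_sum_right mult.commute)
      also have "\<dots> = (\<Sum>i\<in>UNIV. ((A p *v x) $ i) *\<^sub>R E i p)"
        by (subst sum.swap) (simp add: matrix_vector_mult_def scaleR_sum_left)
      finally have "(\<Sum>i'\<in>UNIV. (x $ i') *\<^sub>R E' i' p) = 0" by (simp add: x)
      then have "x $ i = 0" for i using basis_combination_eq_0[OF V'(2), of p "\<lambda>i. x $ i"] p by simp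
      then show "x = 0" by (simp add: vec_eq_iff)
    qed
    then show ?thesis
      by (meson invertible_left_inverse matrix_left_invertible_ker)
  qed
  moreover have "C1_function \<A> (V \<inter> V') (\<lambda>p. A p $ i $ i')" for i i'
    unfolding C1_function_def
  proof
    fix c assume c: "c \<in> \<A>"
    let ?T = "coord c ` (V \<inter> V' \<inter> chart_dom c)"
    have T: "open ?T" using V V' c by (intro open_coord_image) auto
    have E_C1: "Ck_on 1 ?T (\<lambda>x. E i (param c x) c)" for i
      by (rule Ck_on_1_subset[OF local_basis_Ck_on_1[OF V(2) c]]) blast
    have E'_C1: "Ck_on 1 ?T (\<lambda>x. E' i (param c x) c)" for i
      by (rule Ck_on_1_subset[OF local_basis_Ck_on_1[OF V'(2) c]]) blast
    define B :: "real ^ 'n \<Rightarrow> real ^ 'n ^ 'n" where "B x = (\<chi> k j. E j (param c x) c $ k)" for x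
    \<comment> \<open>The numerator in Cramer's rule: column \<open>i\<close> of \<open>B\<close> is replaced by the components of \<open>E'\<^sub>i\<^sub>'\<close>.\<close>
    define Bi where "Bi x = (\<chi> k j. if j = i then E' i' (param c x) c $ k else B x $ k $ j)" for x
    have B_mult: "B (coord c p) *v x = (\<Sum>j\<in>UNIV. (x $ j) *\<^sub>R E j p c)" if "p \<in> chart_dom c" for x p
      using that c by (simp add: B_def vec_eq_iff matrix_vector_mult_def mult.commute)
    have det: "det (B x) \<noteq> 0" if "x \<in> ?T" for x
    proof -
      from that obtain p where p: "p \<in> V" "p \<in> chart_dom c" "x = coord c p" by auto
      have "y = 0" if "B x *v y = 0" for y
        using basis_combination_in_chart_eq_0[OF V(2) p(1) c p(2), of "\<lambda>j. y $ j"] that B_mult[OF p(2)] p(3)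
        by (simp add: vec_eq_iff)
      then show ?thesis
        by (meson invertible_det_nz invertible_left_inverse matrix_left_invertible_ker)
    qed
    have "Ck_on 1 ?T (\<lambda>x. det (Bi x) / det (B x))"
    proof (intro Ck_on_1_divide Ck_on_1_det det)
      show *: "Ck_on 1 ?T (\<lambda>x. B x $ k $ j)" for k j
        unfolding B_def by (simp del: One_nat_def add: Ck_on_1_component[OF E_C1])
      show "Ck_on 1 ?T (\<lambda>x. Bi x $ k $ j)" for k j
        using * Ck_on_1_component[OF E'_C1] unfolding Bi_def by (cases "j = i") (simp_all del: One_nat_def)
    qed
    then show "Ck_on 1 ?T ((\<lambda>p. A p $ i $ i') \<circ> param c)"
    proof (rule Ck_on_1_cong[OF _ T])
      fix x assume x: "x \<in> ?T"
      then obtain p where p: "p \<in> V \<inter> V'" "p \<in> chart_dom c" "x = coord c p" by auto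
      have "B x *v column i' (A p) = E' i' p c"
        using B_mult[OF p(2)] p(3) by (simp add: A[OF p(1)] column_def sum_fun_apply)
      then have "column i' (A p) = (\<chi> k. det (\<chi> i j. if j = k then E' i' p c $ i else B x $ i $ j) / det (B x))"
        using cramer[OF det[OF x]] by simp
      moreover have "Bi x = (\<chi> k j. if j = i then E' i' p c $ k else B x $ k $ j)"
        by (simp only: Bi_def p(3) param_coord[OF c p(2)])
      ultimately have "column i' (A p) $ i = det (Bi x) / det (B x)" by simp
      then have "A p $ i $ i' = det (Bi x) / det (B x)" by (simp add: column_def)
      then show "det (Bi x) / det (B x) = ((\<lambda>p. A p $ i $ i') \<circ> param c) x"
        using p(2,3) c by simp
    qed
  qed
  ultimately show ?thesis unfolding change_of_basis_def using A by blast
qed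

section \<open>The Leibniz rule\<close>

text \<open>Only the first term of \<open>[X, Y]\<^sup>k = X\<^sup>l \<partial>\<^sub>l Y\<^sup>k - Y\<^sup>l \<partial>\<^sub>l X\<^sup>k\<close> differentiates the coefficients \<open>f\<^sub>i\<close>
  of \<open>Y\<close>; the second term and \<open>S\<^sub>X Y\<close> are linear in the value of \<open>Y\<close> at \<open>p\<close>. The identity is stated
  between components in a chart because those of the Lie bracket are what is computed.\<close>

lemma S_derivation_combination:
  assumes X: "X \<in> C1_vector_fields \<A> (topspace M)" "tensor_field_11 M \<A> (S X)"
    and E: "local_basis \<A> V E"
    and N: "openin M N" "N \<subseteq> V"
    and f: "\<And>i. C1_function \<A> N (f i)"
    and Y: "\<And>q. q \<in> N \<Longrightarrow> Y q = (\<Sum>i\<in>UNIV. f i q *\<^sub>R E i q)"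
    and p: "p \<in> N" and c: "c \<in> \<A>" "p \<in> chart_dom c"
  shows "S_derivation \<A> S X Y p c =
    (\<Sum>i\<in>UNIV. frechet_derivative (f i \<circ> param c) (at (coord c p)) (X p c) *\<^sub>R E i p c) +
    (\<Sum>i\<in>UNIV. f i p *\<^sub>R S_derivation \<A> S X (E i) p c)"
proof -
  let ?x = "coord c p"
  let ?D = "\<lambda>g. frechet_derivative g (at ?x)"
  let ?X = "\<lambda>x. X (param c x) c" and ?E = "\<lambda>i x. E i (param c x) c"
  have pM: "p \<in> topspace M" and pV: "p \<in> V"
    using c chart_dom_subset[OF c(1)] p N by blast+
  have dX: "(?X has_derivative ?D ?X) (at ?x)"
    using X(1) c pM unfolding C1_vector_fields_def
    by (intro Ck_on_1_has_derivative[where T = "coord c ` (topspace M \<inter> chart_dom c)"]) auto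
  then interpret dX: linear "?D ?X" by (rule has_derivative_linear)
  have dE: "(?E i has_derivative ?D (?E i)) (at ?x)" for i
    by (rule Ck_on_1_has_derivative[OF local_basis_Ck_on_1[OF E c(1)]]) (use c pV in blast)
  have df: "(f i \<circ> param c has_derivative ?D (f i \<circ> param c)) (at ?x)" for i
    using f[of i] c p unfolding C1_function_def
    by (intro Ck_on_1_has_derivative[where T = "coord c ` (N \<inter> chart_dom c)"]) auto
  have "((\<lambda>x. \<Sum>i\<in>UNIV. (f i \<circ> param c) x *\<^sub>R ?E i x) has_derivative
     (\<lambda>h. \<Sum>i\<in>UNIV. (f i \<circ> param c) ?x *\<^sub>R ?D (?E i) h + ?D (f i \<circ> param c) h *\<^sub>R ?E i ?x)) (at ?x)"
    by (intro has_derivative_sum has_derivative_scaleR df dE)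
  then have "((\<lambda>x. Y (param c x) c) has_derivative
     (\<lambda>h. \<Sum>i\<in>UNIV. (f i \<circ> param c) ?x *\<^sub>R ?D (?E i) h + ?D (f i \<circ> param c) h *\<^sub>R ?E i ?x)) (at ?x)"
    by (rule has_derivative_transform_within_open[OF _ open_coord_image[OF c(1) N(1)]])
       (use p c in \<open>auto simp: Y sum_fun_apply\<close>)
  then have dY: "?D (\<lambda>x. Y (param c x) c) =
     (\<lambda>h. \<Sum>i\<in>UNIV. f i p *\<^sub>R ?D (?E i) h + ?D (f i \<circ> param c) h *\<^sub>R E i p c)"
    using c by (simp flip: frechet_derivative_at)
  have ss: "subspace (tangent_space \<A> p)" using subspace_tangent_space[OF E pV] .
  have Etan: "f i p *\<^sub>R E i p \<in> tangent_space \<A> p" for i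
    using ss basis_in_tangent_space[OF E pV] by (intro subspace_scale)
  have S_scale: "S X p (r *\<^sub>R E i p) = r *\<^sub>R S X p (E i p)" for r i
    using X(2) pM basis_in_tangent_space[OF E pV] unfolding tensor_field_11_def by blast
  have S_zero: "S X p 0 = 0" using S_scale[of 0] by simp
  have S_sum: "S X p (\<Sum>i\<in>I. f i p *\<^sub>R E i p) = (\<Sum>i\<in>I. f i p *\<^sub>R S X p (E i p))" if "finite I" for I
    using that
  proof (induction I rule: finite_induct)
    case empty
    show ?case by (simp only: sum.empty S_zero)
  next
    case (insert i I)
    have "(\<Sum>i\<in>I. f i p *\<^sub>R E i p) \<in> tangent_space \<A> p" using ss Etan by (intro subspace_sum)
    then have "S X p (f i p *\<^sub>R E i p + (\<Sum>i\<in>I. f i p *\<^sub>R E i p)) =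
        S X p (f i p *\<^sub>R E i p) + S X p (\<Sum>i\<in>I. f i p *\<^sub>R E i p)"
      using X(2) pM Etan unfolding tensor_field_11_def by blast
    then show ?case by (simp only: sum.insert[OF insert.hyps] insert.IH S_scale)
  qed
  show ?thesis
    using c by (simp add: S_derivation_def lie_bracket_def dY Y[OF p] S_sum sum_fun_apply
      dX.sum dX.scale scaleR_add_right scaleR_diff_right sum.distrib sum_subtractf)
qed

end

theorem proposition5:
  fixes M :: "'a topology"
    and \<A> :: "('a, 'n::finite) chart set"
    and U V V' :: "'a set"
    and S :: "('a, 'n) vector_field \<Rightarrow> 'a \<Rightarrow> ('a, 'n) tangent_vector \<Rightarrow> ('a, 'n) tangent_vector"
    and E E' :: "'n \<Rightarrow> ('a, 'n) vector_field"
    and W W' :: "('a, 'n) vector_field \<Rightarrow> 'a \<Rightarrow> real ^ 'n ^ 'n"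
  assumes "differentiable_manifold M \<A>"
    and "U \<subseteq> topspace M"
    and "\<And>X. X \<in> C1_vector_fields \<A> (topspace M) \<Longrightarrow> tensor_field_11 M \<A> (S X)"
    and "openin M V" and "U \<subseteq> V" and "local_basis \<A> V E"
    and "\<And>X. X \<in> C1_vector_fields \<A> (topspace M) \<Longrightarrow> S_components \<A> S V E X (W X)"
    and "\<And>X p i j. X \<in> C1_vector_fields \<A> (topspace M) \<Longrightarrow> p \<in> U \<Longrightarrow> W X p $ i $ j = 0"
    and "openin M V'" and "U \<subseteq> V'" and "local_basis \<A> V' E'"
    and "\<And>X. X \<in> C1_vector_fields \<A> (topspace M) \<Longrightarrow> S_components \<A> S V' E' X (W' X)"
    and "\<And>X p i j. X \<in> C1_vector_fields \<A> (topspace M) \<Longrightarrow> p \<in> U \<Longrightarrow> W' X p $ i $ j = 0"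
  shows "(\<exists>A. change_of_basis \<A> (V \<inter> V') E E' A) \<and>
    (\<forall>A. change_of_basis \<A> (V \<inter> V') E E' A \<longrightarrow>
       (\<forall>p\<in>U. \<forall>i j i'. action \<A> (E j) (\<lambda>q. A q $ i $ i') p = 0))"
proof (intro conjI allI impI ballI)
  show "\<exists>A. change_of_basis \<A> (V \<inter> V') E E' A"
    using exists_change_of_basis[OF assms(1,4,6,9,11)] .
next
  fix A p i j i'
  assume A: "change_of_basis \<A> (V \<inter> V') E E' A" and p: "p \<in> U"
  \<comment> \<open>The chart in which \<open>action\<close> is evaluated at \<open>p\<close>.\<close>
  define c where "c = (SOME c. c \<in> \<A> \<and> p \<in> chart_dom c)"
  have "\<exists>c. c \<in> \<A> \<and> p \<in> chart_dom c" using p assms(2) chart_cover[OF assms(1)] by blast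
  then have "c \<in> \<A> \<and> p \<in> chart_dom c" unfolding c_def by (rule someI_ex)
  then have c: "c \<in> \<A>" "p \<in> chart_dom c" by blast+
  have pV: "p \<in> V" "p \<in> V'" using p assms(5,10) by auto
  have "p \<in> topspace M" using p assms(2) by blast
  then obtain X where X: "X \<in> C1_vector_fields \<A> (topspace M)" "X p = E j p"
    using exists_C1_vector_field_with_value[OF assms(1)] basis_in_tangent_space[OF assms(6) pV(1)]
    by metis
  have DE: "S_derivation \<A> S X (E k) p = 0" for k
    using assms(7)[OF X(1)] pV(1) assms(8)[OF X(1) p] by (simp add: S_components_def)
  have DE': "S_derivation \<A> S X (E' k) p = 0" for k
    using assms(12)[OF X(1)] pV(2) assms(13)[OF X(1) p] by (simp add: S_components_def)
  have "S_derivation \<A> S X (E' i') p c =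
    (\<Sum>k\<in>UNIV. frechet_derivative ((\<lambda>q. A q $ k $ i') \<circ> param c) (at (coord c p)) (X p c) *\<^sub>R E k p c) +
    (\<Sum>k\<in>UNIV. A p $ k $ i' *\<^sub>R S_derivation \<A> S X (E k) p c)"
    by (rule S_derivation_combination[where S = S and N = "V \<inter> V'" and f = "\<lambda>k q. A q $ k $ i'",
          OF assms(1) X(1) assms(3)[OF X(1)] assms(6)])
       (use A assms(4,9) pV c in \<open>auto simp: change_of_basis_def\<close>)
  then have "(\<Sum>k\<in>UNIV. frechet_derivative ((\<lambda>q. A q $ k $ i') \<circ> param c) (at (coord c p)) (E j p c)
      *\<^sub>R E k p c) = 0"
    by (simp add: DE DE' X(2))
  then have "frechet_derivative ((\<lambda>q. A q $ i $ i') \<circ> param c) (at (coord c p)) (E j p c) = 0"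
    by (rule basis_combination_in_chart_eq_0[OF assms(1,6) pV(1) c])
  then show "action \<A> (E j) (\<lambda>q. A q $ i $ i') p = 0"
    by (simp only: action_def Let_def c_def[symmetric])
qed

end
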